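(* Let $\mathbb{A}_n$ ($n\geq1$) be the linear tree with $n$ vertices. The number of points over $\mathbb{F}_q$ on the varieties attached to $\mathbb{A}_n$ is given by $$N_{\mathbb{A}_n}=\frac{q^{n+2}-1}{q^2-1}$$ if $n$ is even, and by $$N_{\mathbb{A}_n}^{\mathtt{versal}}=\frac{q^{n+2}+1}{q+1}\quad\text{and}\quad N_{\mathbb{A}_n}^{\mathtt{generic}}=\frac{(q^{(n+1)/2}-1)(q^{(n+3)/2}-1)}{q^2-1}$$ if $n$ is odd.
   Context: A tree is a finite connected simply-connected graph. A vertex cover of a tree $T$ is a set of vertices meeting every edge; a minimum vertex cover is one of minimal cardinality. Canonical coloring: a vertex of $T$ is green if it lies in all minimum vertex covers, orange if it lies in some but not all minimum vertex covers, red if it lies in none. A matching of $T$ is a set of edges (called dominoes) such that every vertex lies in at most one of them; a maximum matching is one of maximal cardinality. Known fact: every maximum matching covers all orange and green vertices, so uncovered vertices are red. The red-green components of $T$ are the connected components of the graph whose vertices are the red and green vertices of $T$ and whose edges are the edges of $T$ with one red end and one green end. For $\mathbb{A}_n$: if $n$ is even all vertices are orange and there is no red-green component; if $n$ is odd, the vertices are alternately red and green, starting and ending with red, and there is exactly one red-green component. Varieties over $k=\mathbb{F}_q$: given $T$, a function $\phi$ from the set of red-green components of $T$ to $\{\mathtt{generic},\mathtt{versal}\}$, a maximum matching $M$, and for every component $C$ with $\phi(C)=\mathtt{generic}$ and every vertex $u$ of $C$ not covered by $M$ a fixed value $\alpha_u\in k^\times$, $X^\phi_T$ is the affine scheme over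 $k$ with variables $x_i,x'_i$ for all vertices $i$ of $T$ and $\alpha_i$ for all vertices $i$ not covered by $M$ lying in components $C$ with $\phi(C)=\mathtt{versal}$, defined by the equations $x_ix'_i=1+\alpha_i\prod_{j} x_j$ for all vertices $i$ (product over the vertices $j$ adjacent to $i$) and the condition that all variables $\alpha_i$ are invertible; here $\alpha_i=1$ whenever $i$ is covered by $M$. When $\phi$ is constant one writes $X_T^{\mathtt{generic}}$, $X_T^{\mathtt{versal}}$, and simply $X_T$ if all vertices of $T$ are orange; $N_T^{\mathtt{generic}}$, $N_T^{\mathtt{versal}}$, $N_T$ denote the corresponding numbers of $\mathbb{F}_q$-points. Genericity condition (always assumed for every generic component $C$): a non-empty set $S$ of red vertices of $C$ is admissible if every green vertex of $C$ has either $0$ or $2$ neighbors in $S$. For every admissible set $S$ and every choice of signs $\varepsilon:S\to\{1,-1\}$ such that two distinct elements of $S$ sharing a common green neighbor have opposite signs, one requires $\prod_{i\in S}\alpha_i^{\varepsilon_i}\neq(-1)^{\#S}$. The generic formula holds for every choice of parameters satisfying this condition. *)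

theory Defs
  imports Complex_Main "HOL-Library.FuncSet" "HOL-Library.Cardinality"
begin

text \<open>The definitions below make sense for every finite simple graph: an edge is a two-element
  set of vertices.\<close>

datatype 'v graph = Graph (verts: "'v set") (edges: "'v set set")

definition neighbors :: "'v graph \<Rightarrow> 'v \<Rightarrow> 'v set" where
  "neighbors T i = {j \<in> verts T. {i, j} \<in> edges T}"

definition linear_tree :: "nat \<Rightarrow> nat graph" where
  "linear_tree n = Graph {1..n} {{i, Suc i} |i. 1 \<le> i \<and> i < n}"

definition vertex_cover :: "'v graph \<Rightarrow> 'v set \<Rightarrow> bool" where
  "vertex_cover T S \<longleftrightarrow> S \<subseteq> verts T \<and> (\<forall>e \<in> edges T. e \<inter> S \<noteq> {})"

definition minimum_vertex_cover :: "'v graph \<Rightarrow> 'v set \<Rightarrow> bool" where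
  "minimum_vertex_cover T S \<longleftrightarrow>
     vertex_cover T S \<and> (\<forall>S'. vertex_cover T S' \<longrightarrow> card S \<le> card S')"

text \<open>The canonical coloring; the remaining vertices are the orange ones.\<close>

definition green :: "'v graph \<Rightarrow> 'v set" where
  "green T = {i \<in> verts T. \<forall>S. minimum_vertex_cover T S \<longrightarrow> i \<in> S}"

definition red :: "'v graph \<Rightarrow> 'v set" where
  "red T = {i \<in> verts T. \<forall>S. minimum_vertex_cover T S \<longrightarrow> i \<notin> S}"

definition matching :: "'v graph \<Rightarrow> 'v set set \<Rightarrow> bool" where
  "matching T M \<longleftrightarrow> M \<subseteq> edges T \<and> pairwise disjnt M"

definition maximum_matching :: "'v graph \<Rightarrow> 'v set set \<Rightarrow> bool" where
  "maximum_matching T M \<longleftrightarrow> matching T M \<and> (\<forall>M'. matching T M' \<longrightarrow> card M' \<le> card M)"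

definition uncovered :: "'v graph \<Rightarrow> 'v set set \<Rightarrow> 'v set" where
  "uncovered T M = verts T - \<Union>M"

definition red_green_adj :: "'v graph \<Rightarrow> ('v \<times> 'v) set" where
  "red_green_adj T = {(i, j). {i, j} \<in> edges T \<and>
     (i \<in> red T \<and> j \<in> green T \<or> i \<in> green T \<and> j \<in> red T)}"

text \<open>Connected components, each given by its vertex set. An isolated vertex is a component.\<close>

definition red_green_components :: "'v graph \<Rightarrow> 'v set set" where
  "red_green_components T = (red T \<union> green T) // (red_green_adj T)\<^sup>*"

datatype kind = generic | versal

text \<open>A function \<open>\<phi>\<close> on components is a total function of which only the values on
  \<^term>\<open>red_green_components T\<close> matter.\<close>

definition uncovered_of_kind ::
  "kind \<Rightarrow> 'v graph \<Rightarrow> ('v set \<Rightarrow> kind) \<Rightarrow> 'v set set \<Rightarrow> 'v set" where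
  "uncovered_of_kind c T \<phi> M =
     {u \<in> uncovered T M. \<exists>C \<in> red_green_components T. u \<in> C \<and> \<phi> C = c}"

definition admissible :: "'v graph \<Rightarrow> 'v set \<Rightarrow> 'v set \<Rightarrow> bool" where
  "admissible T C S \<longleftrightarrow> S \<noteq> {} \<and> S \<subseteq> C \<inter> red T \<and>
     (\<forall>g \<in> C \<inter> green T. card (neighbors T g \<inter> S) \<in> {0, 2})"

definition alternating_signs :: "'v graph \<Rightarrow> 'v set \<Rightarrow> ('v \<Rightarrow> int) \<Rightarrow> bool" where
  "alternating_signs T S \<epsilon> \<longleftrightarrow> (\<forall>i \<in> S. \<epsilon> i \<in> {1, -1}) \<and>
     (\<forall>i \<in> S. \<forall>j \<in> S. i \<noteq> j \<and> neighbors T i \<inter> neighbors T j \<inter> green T \<noteq> {} \<longrightarrow> \<epsilon> i = - \<epsilon> j)"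

text \<open>The fixed values \<open>\<alpha>\<close> are only meaningful at the uncovered vertices of the generic
  components; in a tree, every uncovered vertex is red, hence lies in a component.\<close>

definition generic_parameters ::
  "'v graph \<Rightarrow> ('v set \<Rightarrow> kind) \<Rightarrow> 'v set set \<Rightarrow> ('v \<Rightarrow> 'k::field) \<Rightarrow> bool" where
  "generic_parameters T \<phi> M \<alpha> \<longleftrightarrow>
     (\<forall>u \<in> uncovered_of_kind generic T \<phi> M. \<alpha> u \<noteq> 0) \<and>
     (\<forall>C \<in> red_green_components T. \<phi> C = generic \<longrightarrow>
        (\<forall>S \<epsilon>. admissible T C S \<and> alternating_signs T S \<epsilon> \<longrightarrow>
           (\<Prod>i\<in>S. (if i \<in> uncovered T M then \<alpha> i else 1) powi \<epsilon> i) \<noteq> (-1) ^ card S))"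

definition coefficient ::
  "'v graph \<Rightarrow> ('v set \<Rightarrow> kind) \<Rightarrow> 'v set set \<Rightarrow> ('v \<Rightarrow> 'k) \<Rightarrow> ('v \<Rightarrow> 'k) \<Rightarrow> 'v \<Rightarrow> 'k::field" where
  "coefficient T \<phi> M \<alpha> a i =
     (if i \<notin> uncovered T M then 1
      else if i \<in> uncovered_of_kind versal T \<phi> M then a i
      else \<alpha> i)"

text \<open>The points over the base field of the affine scheme \<open>X\<^sub>T\<^sup>\<phi>\<close>: the solutions
  \<open>(x, x', a)\<close> of its equations, where \<open>a\<close> is the family of the versal variables
  and \<open>\<alpha>\<close> the family of the fixed generic values.\<close>

definition X_points ::
  "'v graph \<Rightarrow> ('v set \<Rightarrow> kind) \<Rightarrow> 'v set set \<Rightarrow> ('v \<Rightarrow> 'k::field)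
     \<Rightarrow> (('v \<Rightarrow> 'k) \<times> ('v \<Rightarrow> 'k) \<times> ('v \<Rightarrow> 'k)) set" where
  "X_points T \<phi> M \<alpha> =
     {(x, x', a).
        x \<in> verts T \<rightarrow>\<^sub>E UNIV \<and> x' \<in> verts T \<rightarrow>\<^sub>E UNIV \<and>
        a \<in> uncovered_of_kind versal T \<phi> M \<rightarrow>\<^sub>E UNIV - {0} \<and>
        (\<forall>i \<in> verts T. x i * x' i = 1 + coefficient T \<phi> M \<alpha> a i * (\<Prod>j \<in> neighbors T i. x j))}"

definition N_points ::
  "'v graph \<Rightarrow> ('v set \<Rightarrow> kind) \<Rightarrow> 'v set set \<Rightarrow> ('v \<Rightarrow> 'k::{field,finite}) \<Rightarrow> nat" where
  "N_points T \<phi> M \<alpha> = card (X_points T \<phi> M \<alpha>)"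

end

theory Submission
  imports Defs
begin

text \<open>
  Put \<open>x\<^sub>0 = 1\<close>, let \<open>c\<^sub>i\<close> be the coefficient in the equation at the vertex \<open>i\<close>, and let
  \<open>B\<^sub>m(y)\<close> be the number of solutions of the first \<open>m\<close> equations with \<open>x\<close>-value \<open>y \<noteq> 0\<close> at
  \<open>m + 1\<close>; the number sought is \<open>B\<^sub>n(1)\<close>. If the \<open>x\<close>-value at \<open>m + 2\<close> is some \<open>z \<noteq> 0\<close>, the
  equation there only determines \<open>x'\<close>; if it is 0, then \<open>x'\<close> is free, the previous \<open>x\<close>-value
  must be \<open>-1 / (c\<^sub>m\<^sub>+\<^sub>2 y)\<close>, and the equation at \<open>m + 1\<close> only determines \<open>x'\<close>. Hence
  \<open>B\<^sub>m\<^sub>+\<^sub>2(y) = U\<^sub>m\<^sub>+\<^sub>1 + q B\<^sub>m(-1 / (c\<^sub>m\<^sub>+\<^sub>2 y))\<close>, where \<open>U\<^sub>m\<close>, the sum of \<open>B\<^sub>m(z)\<close> over \<open>z \<noteq> 0\<close>,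
  satisfies \<open>U\<^sub>m\<^sub>+\<^sub>2 = (q - 1) U\<^sub>m\<^sub>+\<^sub>1 + q U\<^sub>m\<close> and does not depend on \<open>c\<close>.

  For even \<open>n\<close> this determines \<open>B\<^sub>n(1)\<close>. For odd \<open>n = 2k + 1\<close> the recursion ends with
  \<open>q\<^sup>k\<^sup>+\<^sup>1\<close> extra solutions at a single resonant value of \<open>y\<close>, and none elsewhere. A maximum
  matching leaves exactly one vertex \<open>u\<close> uncovered, \<open>u\<close> is odd, and \<open>y = 1\<close> is resonant exactly
  when \<open>\<alpha>\<^sub>u = (-1)\<^sup>k\<^sup>+\<^sup>1\<close>. The genericity condition for the only admissible set, that of the odd
  vertices, excludes this value, while the versal variable takes it exactly once.
\<close>

section \<open>Counting solutions along a chain\<close>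

text \<open>Position 0 is an auxiliary vertex with value 1, so the equation at vertex 1 has the
  general shape. The last two values are both prescribed because adding an equation involves
  both.\<close>

definition chain_points ::
  "(nat \<Rightarrow> 'k::field) \<Rightarrow> nat \<Rightarrow> 'k \<Rightarrow> 'k \<Rightarrow> ((nat \<Rightarrow> 'k) \<times> (nat \<Rightarrow> 'k)) set" where
  "chain_points c m v y =
     {(x, x'). x \<in> {..Suc m} \<rightarrow>\<^sub>E UNIV \<and> x' \<in> {1..m} \<rightarrow>\<^sub>E UNIV \<and>
        x 0 = 1 \<and> x m = v \<and> x (Suc m) = y \<and>
        (\<forall>i \<in> {1..m}. x i * x' i = 1 + c i * x (i - 1) * x (Suc i))}"

lemma finite_chain_points [simp]:
  "finite (chain_points c m v (y :: 'k::{field,finite}))"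
proof (rule finite_subset)
  show "chain_points c m v y \<subseteq> ({..Suc m} \<rightarrow>\<^sub>E UNIV) \<times> ({1..m} \<rightarrow>\<^sub>E UNIV)"
    by (auto simp: chain_points_def)
qed (intro finite_cartesian_product finite_PiE; simp)

lemma card_chain_points_0: "card (chain_points c 0 v y) = (if v = 1 then 1 else 0)"
proof (cases "v = 1")
  case True
  have "chain_points c 0 v y = {(\<lambda>i. if i = 0 then 1 else if i = 1 then y else undefined, \<lambda>_. undefined)}"
    using True
    by (auto simp: chain_points_def PiE_def extensional_def fun_eq_iff not_le)
  then show ?thesis using True by simp
next
  case False
  then have "chain_points c 0 v y = {}" by (auto simp: chain_points_def)
  then show ?thesis using False by simp
qed

text \<open>Dropping the end value \<open>y\<close> and the last \<open>x'\<close>-value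
  \<open>w\<close> leaves a shorter chain ending in \<open>v\<close>, \<open>z\<close>; the last
  equation constrains only \<open>w\<close>.\<close>

lemma card_chain_points_Suc:
  fixes c :: "nat \<Rightarrow> 'k::{field,finite}"
  shows "card (chain_points c (Suc m) z y) =
    (\<Sum>v\<in>UNIV. card (chain_points c m v z) * card {w. z * w = 1 + c (Suc m) * v * y})"
proof -
  define R where "R = (SIGMA v : UNIV. chain_points c m v z \<times> {w. z * w = 1 + c (Suc m) * v * y})"
  define f where "f = (\<lambda>(v :: 'k, (x, x'), w). (x(Suc (Suc m) := y), x'(Suc m := w :: 'k)))"
  define g where "g = (\<lambda>(x, x'). (x m :: 'k,
    (x(Suc (Suc m) := undefined), x'(Suc m := undefined)), x' (Suc m) :: 'k))"
  \<comment> \<open>The lower bound is \<open>Suc 0\<close> because the simplifier turns 1 into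
    it.\<close>
  have ball: "(\<forall>i\<in>{Suc 0..Suc m}. P i) \<longleftrightarrow> (\<forall>i\<in>{Suc 0..m}. P i) \<and> P (Suc m)" for P
    by (simp add: atLeastAtMostSuc_conv conj_commute)
  have "bij_betw f R (chain_points c (Suc m) z y)"
  proof (rule bij_betw_byWitness[where f' = g])
    show "\<forall>a\<in>R. g (f a) = a"
      by (auto simp: R_def f_def g_def chain_points_def PiE_def extensional_def fun_eq_iff)
    show "\<forall>a\<in>chain_points c (Suc m) z y. f (g a) = a"
      by (auto simp: f_def g_def chain_points_def)
    show "f ` R \<subseteq> chain_points c (Suc m) z y"
      by (auto simp: R_def f_def chain_points_def PiE_def extensional_def le_Suc_eq)
    show "g ` chain_points c (Suc m) z y \<subseteq> R"
      by (auto simp: R_def g_def chain_points_def PiE_def extensional_def le_Suc_eq ball)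
  qed
  then have "card (chain_points c (Suc m) z y) = card R"
    by (metis bij_betw_same_card)
  also have "\<dots> = (\<Sum>v\<in>UNIV. card (chain_points c m v z) * card {w. z * w = 1 + c (Suc m) * v * y})"
    unfolding R_def by (subst card_SigmaI) (auto simp: card_cartesian_product)
  finally show ?thesis .
qed

section \<open>Recursions in the length of the chain\<close>

text \<open>This is \<open>B\<^sub>m(y)\<close> of the overview.\<close>

definition chain_count :: "(nat \<Rightarrow> 'k::{field,finite}) \<Rightarrow> nat \<Rightarrow> 'k \<Rightarrow> nat" where
  "chain_count c m y = (\<Sum>v\<in>UNIV. card (chain_points c m v y))"

lemma card_chain_points_Suc_nonzero:
  assumes "z \<noteq> 0"
  shows "card (chain_points c (Suc m) z y) = chain_count c m z"
proof -
  have "{w. z * w = t} = {t / z}" for t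
    using assms by (auto simp: field_simps)
  then show ?thesis
    by (simp add: card_chain_points_Suc chain_count_def)
qed

text \<open>With \<open>z = 0\<close> the last equation no longer contains \<open>w\<close>: it
  fixes the preceding value and leaves all \<open>q\<close> choices of \<open>w\<close>.\<close>

lemma card_chain_points_Suc_zero:
  fixes c :: "nat \<Rightarrow> 'k::{field,finite}"
  assumes "y \<noteq> 0" and "c (Suc m) \<noteq> 0"
  shows "card (chain_points c (Suc m) 0 y) =
    CARD('k) * card (chain_points c m (- 1 / (c (Suc m) * y)) 0)"
proof -
  have eq: "0 = 1 + c (Suc m) * v * y \<longleftrightarrow> v = - 1 / (c (Suc m) * y)" for v
    using assms by (auto simp: field_simps add_eq_0_iff)
  have "card {w::'k. 0 * w = 1 + c (Suc m) * v * y} = 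
      (if v = - 1 / (c (Suc m) * y) then CARD('k) else 0)" for v
  proof (cases "v = - 1 / (c (Suc m) * y)")
    case True
    then have "{w::'k. 0 * w = 1 + c (Suc m) * v * y} = UNIV"
      using eq[of v] by auto
    with True show ?thesis by simp
  next
    case False
    then have "{w::'k. 0 * w = 1 + c (Suc m) * v * y} = {}"
      using eq[of v] by auto
    with False show ?thesis by simp
  qed
  then show ?thesis
    unfolding card_chain_points_Suc by (simp add: if_distrib[of "(*) _"] mult.commute[of "CARD('k)"] cong: if_cong)
qed

lemma chain_count_0: "chain_count c 0 y = 1"
  by (simp add: chain_count_def card_chain_points_0)

text \<open>This is \<open>U\<^sub>m\<close> of the overview.\<close>

definition chain_total :: "(nat \<Rightarrow> 'k::{field,finite}) \<Rightarrow> nat \<Rightarrow> nat" where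
  "chain_total c m = (\<Sum>z\<in>UNIV - {0}. chain_count c m z)"

lemma chain_count_Suc:
  fixes c :: "nat \<Rightarrow> 'k::{field,finite}"
  assumes "y \<noteq> 0" and "c (Suc m) \<noteq> 0"
  shows "chain_count c (Suc m) y =
    chain_total c m + CARD('k) * card (chain_points c m (- 1 / (c (Suc m) * y)) 0)"
proof -
  have "chain_count c (Suc m) y = card (chain_points c (Suc m) 0 y) +
      (\<Sum>z\<in>UNIV - {0}. card (chain_points c (Suc m) z y))"
    unfolding chain_count_def by (rule sum.remove) auto
  then show ?thesis
    using assms by (simp add: card_chain_points_Suc_zero card_chain_points_Suc_nonzero chain_total_def)
qed

text \<open>A zero at vertex 1 forces the value at 0, which is already 1; this singles out one
  \<open>y\<close> and is the source of the resonance.\<close>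

lemma chain_count_1:
  fixes c :: "nat \<Rightarrow> 'k::{field,finite}"
  assumes "y \<noteq> 0" and "c 1 \<noteq> 0"
  shows "chain_count c 1 y = chain_total c 0 + (if y = - 1 / c 1 then CARD('k) else 0)"
proof -
  have "- 1 / (c 1 * y) = 1 \<longleftrightarrow> y = - 1 / c 1"
    using assms by (auto simp: field_simps)
  then show ?thesis
    using chain_count_Suc[of y c 0] assms by (auto simp: card_chain_points_0)
qed

text \<open>A zero at \<open>m + 2\<close> forces a nonzero value at \<open>m + 1\<close>, so the
  equation there again just determines its \<open>x'\<close>.\<close>

lemma chain_count_Suc_Suc:
  fixes c :: "nat \<Rightarrow> 'k::{field,finite}"
  assumes "y \<noteq> 0" and "c (Suc (Suc m)) \<noteq> 0"
  shows "chain_count c (Suc (Suc m)) y =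
    chain_total c (Suc m) + CARD('k) * chain_count c m (- 1 / (c (Suc (Suc m)) * y))"
  using assms by (simp add: chain_count_Suc card_chain_points_Suc_nonzero)

lemma card_field_ge_2: "CARD('k::{field,finite}) \<ge> 2"
proof -
  have "card {0, 1 :: 'k} \<le> CARD('k)" by (rule card_mono) auto
  then show ?thesis by simp
qed

text \<open>The map \<open>y\<close> to \<open>- 1 / (d * y)\<close> is an involution of the nonzero
  elements.\<close>

lemma sum_nonzero_reindex:
  fixes d :: "'k::{field,finite}"
  assumes "d \<noteq> 0"
  shows "(\<Sum>y\<in>UNIV - {0}. f (- 1 / (d * y))) = (\<Sum>y\<in>UNIV - {0}. f y)"
  by (rule sum.reindex_bij_witness[of _ "\<lambda>y. - 1 / (d * y)" "\<lambda>y. - 1 / (d * y)"])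
     (use assms in \<open>auto simp: field_simps\<close>)

lemma chain_total_0: "chain_total (c :: nat \<Rightarrow> 'k::{field,finite}) 0 = CARD('k) - 1"
  by (simp add: chain_total_def chain_count_0 card_Diff_subset)

lemma chain_total_1:
  fixes c :: "nat \<Rightarrow> 'k::{field,finite}"
  assumes "c 1 \<noteq> 0"
  shows "chain_total c 1 = (CARD('k) - 1)\<^sup>2 + CARD('k)"
proof -
  have "chain_total c 1 =
      (\<Sum>y\<in>UNIV - {0}. (CARD('k) - 1) + (if y = - 1 / c 1 then CARD('k) else 0))"
    unfolding chain_total_def
    by (rule sum.cong) (use assms in \<open>auto simp: chain_count_1 chain_total_0 simp del: One_nat_def\<close>)
  also have "\<dots> = (CARD('k) - 1)\<^sup>2 + CARD('k)"
    using assms unfolding sum.distrib by (simp add: card_Diff_subset power2_eq_square)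
  finally show ?thesis .
qed

lemma chain_total_Suc_Suc:
  fixes c :: "nat \<Rightarrow> 'k::{field,finite}"
  assumes "c (Suc (Suc m)) \<noteq> 0"
  shows "chain_total c (Suc (Suc m)) =
    (CARD('k) - 1) * chain_total c (Suc m) + CARD('k) * chain_total c m"
proof -
  have "chain_total c (Suc (Suc m)) = (\<Sum>y\<in>UNIV - {0}.
      chain_total c (Suc m) + CARD('k) * chain_count c m (- 1 / (c (Suc (Suc m)) * y)))"
    unfolding chain_total_def[of c "Suc (Suc m)"]
    by (rule sum.cong) (use assms in \<open>auto simp: chain_count_Suc_Suc\<close>)
  also have "\<dots> = (CARD('k) - 1) * chain_total c (Suc m) +
      CARD('k) * (\<Sum>y\<in>UNIV - {0}. chain_count c m (- 1 / (c (Suc (Suc m)) * y)))"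
    by (simp add: sum.distrib card_Diff_subset sum_distrib_left)
  finally show ?thesis
    using sum_nonzero_reindex[OF assms, of "chain_count c m"] by (simp add: chain_total_def)
qed

section \<open>Closed forms for totals and counts\<close>

text \<open>The characteristic roots of the two-step recursion are \<open>q\<close> and -1.\<close>

lemma chain_total_closed:
  fixes c :: "nat \<Rightarrow> 'k::{field,finite}"
  defines "q \<equiv> real CARD('k)"
  assumes "\<And>i. i \<ge> 1 \<Longrightarrow> c i \<noteq> 0"
  shows "(q + 1) * real (chain_total c m) = q ^ (m + 2) - (- 1) ^ m"
proof -
  have r: "real (CARD('k) - 1) = q - 1"
    using card_field_ge_2[where 'k = 'k] by (simp add: q_def of_nat_diff)
  show ?thesis
  proof (induction m rule: induct_nat_012)
    case 0
    then show ?case by (simp only: chain_total_0 r) (simp add: algebra_simps power2_eq_square)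
  next
    case 1
    have "real (chain_total c 1) = (q - 1)\<^sup>2 + q"
      using assms by (subst chain_total_1) (auto simp: r)
    then show ?case by (simp only: One_nat_def) (simp add: algebra_simps power2_eq_square power3_eq_cube)
  next
    case (ge2 m)
    have "real (chain_total c (Suc (Suc m))) =
        (q - 1) * real (chain_total c (Suc m)) + q * real (chain_total c m)"
      using assms by (simp add: chain_total_Suc_Suc r)
    then have "(q + 1) * real (chain_total c (Suc (Suc m))) =
        (q - 1) * ((q + 1) * real (chain_total c (Suc m))) + q * ((q + 1) * real (chain_total c m))"
      by (simp only:) (simp add: algebra_simps)
    then show ?case
      unfolding ge2 by (simp only:) (simp add: algebra_simps)
  qed
qed

text \<open>Steps of length two end at the empty chain, whose count is 1 for every end value, so no
  exceptional \<open>y\<close> arises.\<close>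

lemma chain_count_even:
  fixes c :: "nat \<Rightarrow> 'k::{field,finite}"
  defines "q \<equiv> real CARD('k)"
  assumes c: "\<And>i. i \<ge> 1 \<Longrightarrow> c i \<noteq> 0" and "y \<noteq> 0"
  shows "(q\<^sup>2 - 1) * real (chain_count c (2 * k) y) = q ^ (2 * k + 2) - 1"
  using \<open>y \<noteq> 0\<close>
proof (induction k arbitrary: y)
  case 0
  then show ?case by (simp add: chain_count_0 power2_eq_square)
next
  case (Suc k)
  let ?z = "- 1 / (c (2 * k + 2) * y)"
  have z: "?z \<noteq> 0" using Suc.prems c by simp
  have "(q\<^sup>2 - 1) * real (chain_count c (2 * Suc k) y) =
      (q - 1) * ((q + 1) * real (chain_total c (2 * k + 1))) +
      q * ((q\<^sup>2 - 1) * real (chain_count c (2 * k) ?z))"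
    using chain_count_Suc_Suc[of y c "2 * k"] Suc.prems c
    by (simp add: q_def algebra_simps power2_eq_square)
  also have "\<dots> = (q - 1) * (q ^ (2 * k + 3) + 1) + q * (q ^ (2 * k + 2) - 1)"
    unfolding Suc.IH[OF z] using chain_total_closed[of c "2 * k + 1"] c
    by (simp add: q_def numeral_3_eq_3)
  finally show ?case by (simp add: algebra_simps power2_eq_square numeral_3_eq_3)
qed

text \<open>The only value of \<open>x\<close> at the vertex \<open>2k + 2\<close> for which \<open>x\<close> may vanish at all of
  \<open>1, 3, \<dots>, 2k + 1\<close>.\<close>

primrec chain_resonance :: "(nat \<Rightarrow> 'k::field) \<Rightarrow> nat \<Rightarrow> 'k" where
  "chain_resonance c 0 = - 1 / c 1"
| "chain_resonance c (Suc k) = - 1 / (c (2 * k + 3) * chain_resonance c k)"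

lemma chain_resonance_nonzero:
  assumes "\<And>i. i \<ge> 1 \<Longrightarrow> c i \<noteq> 0"
  shows "chain_resonance c k \<noteq> 0"
  by (induction k) (use assms in auto)

text \<open>Steps of length two end at a single vertex with one exceptional end value. Each step
  multiplies its surplus by \<open>q\<close> and moves the exceptional value by an
  involution.\<close>

lemma chain_count_odd:
  fixes c :: "nat \<Rightarrow> 'k::{field,finite}"
  defines "q \<equiv> real CARD('k)"
  assumes c: "\<And>i. i \<ge> 1 \<Longrightarrow> c i \<noteq> 0" and "y \<noteq> 0"
  shows "(q\<^sup>2 - 1) * real (chain_count c (2 * k + 1) y) =
    (q ^ (k + 1) - 1) * (q ^ (k + 2) - 1) +
    (if y = chain_resonance c k then (q\<^sup>2 - 1) * q ^ (k + 1) else 0)"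
  using \<open>y \<noteq> 0\<close>
proof (induction k arbitrary: y)
  case 0
  have "(q + 1) * real (chain_total c 0) = q\<^sup>2 - 1"
    using chain_total_closed[of c 0] c by (simp add: q_def power2_eq_square)
  moreover have "(q\<^sup>2 - 1) * real (chain_total c 0) = (q - 1) * ((q + 1) * real (chain_total c 0))"
    by (simp add: algebra_simps power2_eq_square)
  ultimately have total: "(q\<^sup>2 - 1) * real (chain_total c 0) = (q - 1) * (q\<^sup>2 - 1)"
    by simp
  have "real (chain_count c 1 y) =
      real (chain_total c 0) + (if y = chain_resonance c 0 then q else 0)"
    using chain_count_1[of y c] 0 c by (simp add: q_def)
  then have "(q\<^sup>2 - 1) * real (chain_count c 1 y) =
      (q - 1) * (q\<^sup>2 - 1) + (q\<^sup>2 - 1) * (if y = chain_resonance c 0 then q else 0)"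
    by (simp only: distrib_left total)
  then show ?case by (simp add: numeral_2_eq_2)
next
  case (Suc k)
  let ?z = "- 1 / (c (2 * k + 3) * y)"
  have z: "?z \<noteq> 0" using Suc.prems c by simp
  have iff: "?z = chain_resonance c k \<longleftrightarrow> y = chain_resonance c (Suc k)"
    using Suc.prems c[of "2 * k + 3"] chain_resonance_nonzero[of c k] c by (auto simp: field_simps)
  have "(- 1 :: real) ^ (2 * k + 2) = 1" by simp
  with chain_total_closed[of c "2 * k + 2"] c
  have total: "(q + 1) * real (chain_total c (2 * k + 2)) = q ^ (2 * k + 4) - 1"
    by (simp add: q_def numeral_eq_Suc)
  have "(q\<^sup>2 - 1) * real (chain_count c (2 * Suc k + 1) y) =
      (q - 1) * ((q + 1) * real (chain_total c (2 * k + 2))) +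
      q * ((q\<^sup>2 - 1) * real (chain_count c (2 * k + 1) ?z))"
    using chain_count_Suc_Suc[of y c "2 * k + 1"] Suc.prems c
    by (simp add: q_def algebra_simps power2_eq_square numeral_3_eq_3)
  also have "\<dots> = (q - 1) * (q ^ (2 * k + 4) - 1) + q * ((q ^ (k + 1) - 1) * (q ^ (k + 2) - 1) +
    (if y = chain_resonance c (Suc k) then (q\<^sup>2 - 1) * q ^ (k + 1) else 0))"
    unfolding Suc.IH[OF z] iff total ..
  \<comment> \<open>Abstracting the surplus to \<open>r\<close> separates the polynomial identity
    from the case distinction.\<close>
  also have "(q - 1) * (q ^ (2 * k + 4) - 1) + q * ((q ^ (k + 1) - 1) * (q ^ (k + 2) - 1) + r) =
     (q ^ (Suc k + 1) - 1) * (q ^ (Suc k + 2) - 1) + q * r" for r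
    by (simp add: algebra_simps power_add power_mult power2_eq_square power_mult_distrib numeral_eq_Suc)
  finally show ?case by (simp only: if_distrib) (simp cong: if_cong)
qed

text \<open>Each step inverts and changes the sign, so once \<open>u\<close> is passed,
  \<open>c u\<close> occurs with exponent 1 or -1. Which of the two occurs is left open, since both
  give the same condition for the value 1.\<close>

lemma chain_resonance_single:
  fixes c :: "nat \<Rightarrow> 'k::field"
  assumes "odd u" and c: "\<And>i. i \<noteq> u \<Longrightarrow> c i = 1"
  shows "chain_resonance c k \<in> (if u \<le> 2 * k + 1 then {(- 1) ^ (k + 1) * c u, (- 1) ^ (k + 1) / c u}
    else {(- 1) ^ (k + 1)})"
proof (induction k)
  case 0
  then show ?case using assms by (cases "u = 1") (auto simp: le_Suc_eq)
next
  case (Suc k)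
  have sign: "- 1 / (a * ((- 1) ^ (k + 1) * b)) = (- 1) ^ (Suc k + 1) / (a * b)" for a b :: 'k
    by (cases "even k") auto
  have sign': "- 1 / (a * (- 1) ^ (k + 1)) = (- 1) ^ (Suc k + 1) / a" for a :: 'k
    by (cases "even k") auto
  have sign'': "- 1 / (a * ((- 1) ^ (k + 1) / b)) = (- 1) ^ (Suc k + 1) * b / a" for a b :: 'k
    by (cases "even k") auto
  consider "u \<le> 2 * k + 1" | "u = 2 * k + 3" | "u > 2 * k + 3"
    using \<open>odd u\<close> by (cases "u = 2 * k + 2") (auto, linarith)
  then show ?case
  proof cases
    case 1
    with Suc have "chain_resonance c k \<in> {(- 1) ^ (k + 1) * c u, (- 1) ^ (k + 1) / c u}"
      by simp
    then have "chain_resonance c (Suc k) \<in> {(- 1) ^ (Suc k + 1) / c u, (- 1) ^ (Suc k + 1) * c u}"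
      unfolding chain_resonance.simps using 1 c[of "2 * k + 3"] sign[of 1 "c u"] sign''[of 1 "c u"]
      by fastforce
    with 1 show ?thesis by auto
  next
    case 2
    with Suc have "chain_resonance c k = (- 1) ^ (k + 1)" by simp
    then have "chain_resonance c (Suc k) = (- 1) ^ (Suc k + 1) / c u"
      unfolding chain_resonance.simps 2 by (simp only: sign')
    with 2 show ?thesis by simp
  next
    case 3
    with Suc have "chain_resonance c k = (- 1) ^ (k + 1)" by simp
    then have "chain_resonance c (Suc k) = (- 1) ^ (Suc k + 1)"
      unfolding chain_resonance.simps using 3 c[of "2 * k + 3"] sign'[of 1] by simp
    with 3 show ?thesis by simp
  qed
qed

lemma chain_resonance_single_eq_1:
  fixes c :: "nat \<Rightarrow> 'k::field"
  assumes "odd u" and "u \<le> 2 * k + 1" and "c u \<noteq> 0" and "\<And>i. i \<noteq> u \<Longrightarrow> c i = 1"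
  shows "1 = chain_resonance c k \<longleftrightarrow> c u = (- 1) ^ (k + 1)"
proof -
  have "1 = (- 1) ^ (k + 1) * a \<longleftrightarrow> a = (- 1) ^ (k + 1)" 
       "a \<noteq> 0 \<Longrightarrow> 1 = (- 1) ^ (k + 1) / a \<longleftrightarrow> a = (- 1) ^ (k + 1)" for a :: 'k
    by (cases "even k"; auto simp: field_simps minus_equation_iff)+
  with chain_resonance_single[of u c k] assms show ?thesis by auto
qed

section \<open>Matchings and the canonical coloring of the linear tree\<close>

lemma verts_linear_tree [simp]: "verts (linear_tree n) = {1..n}"
  by (simp add: linear_tree_def)

lemma edge_linear_tree_iff:
  "{i, j} \<in> edges (linear_tree n) \<longleftrightarrow> j = Suc i \<and> 1 \<le> i \<and> j \<le> n \<or> i = Suc j \<and> 1 \<le> j \<and> i \<le> n"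
  by (auto simp: linear_tree_def doubleton_eq_iff)

lemma neighbors_linear_tree:
  "i \<in> {1..n} \<Longrightarrow> neighbors (linear_tree n) i = {i - 1, Suc i} \<inter> {1..n}"
  by (auto simp: neighbors_def edge_linear_tree_iff)

lemma matching_linear_tree_edge:
  assumes "matching (linear_tree n) M" and "e \<in> M"
  obtains i where "e = {i, Suc i}" and "1 \<le> i" and "i < n"
  using assms by (auto simp: matching_def linear_tree_def)

text \<open>Subfamilies are allowed so that the edges on one side of a vertex can be
  counted.\<close>

lemma card_Union_edges_linear_tree:
  assumes "matching (linear_tree n) M" and "N \<subseteq> M"
  shows "card (\<Union>N) = 2 * card N"
proof -
  have *: "finite e \<and> card e = 2" if "e \<in> N" for e
    by (rule matching_linear_tree_edge[of n M e]) (use assms that in auto)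
  have "card (\<Union>N) = sum card N"
  proof (rule card_Union_disjoint)
    show "pairwise disjnt N"
      using assms(1) pairwise_subset[OF _ assms(2)] by (simp add: matching_def)
  qed (use * in blast)
  also have "\<dots> = 2 * card N" using * by simp
  finally show ?thesis .
qed

lemma card_uncovered_linear_tree:
  assumes "maximum_matching (linear_tree n) M"
  shows "card (uncovered (linear_tree n) M) = n mod 2"
proof -
  have M: "matching (linear_tree n) M" using assms by (simp add: maximum_matching_def)
  \<comment> \<open>The edges {1, 2}, {3, 4}, ... bound the size of \<open>M\<close> from below;
    disjointness of edges bounds it from above.\<close>
  define N where "N = (\<lambda>i. {2 * i + 1, 2 * i + 2}) ` {..<n div 2}"
  have "matching (linear_tree n) N"
    by (auto simp: matching_def N_def edge_linear_tree_iff pairwise_def disjnt_def) presburger+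
  moreover have "card N = n div 2"
    unfolding N_def by (subst card_image) (auto simp: inj_on_def doubleton_eq_iff)
  ultimately have ge: "n div 2 \<le> card M"
    using assms by (auto simp: maximum_matching_def)
  have sub: "\<Union>M \<subseteq> {1..n}"
    using M by (auto elim!: matching_linear_tree_edge)
  have card: "card (\<Union>M) = 2 * card M"
    using card_Union_edges_linear_tree[OF M] by simp
  moreover have "card (\<Union>M) \<le> n"
    using card_mono[OF _ sub] by simp
  moreover have "card (uncovered (linear_tree n) M) = n - card (\<Union>M)"
    using sub by (simp add: uncovered_def card_Diff_subset finite_subset)
  ultimately show ?thesis using ge by presburger
qed

lemma uncovered_linear_tree_even:
  assumes "maximum_matching (linear_tree n) M" and "even n"
  shows "uncovered (linear_tree n) M = {}"
  using card_uncovered_linear_tree[OF assms(1)] assms(2) by (simp add: uncovered_def)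

text \<open>The edges of \<open>M\<close> to the left of \<open>u\<close> cover exactly the
  \<open>u - 1\<close> vertices there, so this number is even.\<close>

lemma uncovered_linear_tree_odd:
  assumes "maximum_matching (linear_tree n) M" and "odd n"
  obtains u where "uncovered (linear_tree n) M = {u}" and "odd u" and "u \<le> n"
proof -
  have M: "matching (linear_tree n) M" using assms by (simp add: maximum_matching_def)
  have "card (uncovered (linear_tree n) M) = 1"
    using card_uncovered_linear_tree[OF assms(1)] assms(2) by presburger
  then obtain u where u: "uncovered (linear_tree n) M = {u}"
    by (auto simp: card_1_singleton_iff)
  then have un: "u \<in> {1..n}" "u \<notin> \<Union>M" and cov: "\<And>i. i \<in> {1..n} \<Longrightarrow> i \<noteq> u \<Longrightarrow> i \<in> \<Union>M"
    by (auto simp: uncovered_def)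
  have "\<Union>{e \<in> M. e \<subseteq> {1..<u}} = {1..<u}"
  proof (intro equalityI subsetI)
    fix i assume i: "i \<in> {1..<u}"
    then obtain e where e: "e \<in> M" "i \<in> e" using cov[of i] un by auto
    then obtain j where "e = {j, Suc j}" "1 \<le> j" using M by (auto elim: matching_linear_tree_edge)
    \<comment> \<open>An edge joins consecutive vertices, so one that avoids \<open>u\<close> cannot
      cross it.\<close>
    moreover have "u \<notin> e" using e un by auto
    ultimately have "e \<subseteq> {1..<u}" using i e by auto
    with e show "i \<in> \<Union>{e \<in> M. e \<subseteq> {1..<u}}" by auto
  qed auto
  then have "u - 1 = 2 * card {e \<in> M. e \<subseteq> {1..<u}}"
    using card_Union_edges_linear_tree[OF M, of "{e \<in> M. e \<subseteq> {1..<u}}"] by simp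
  then have "odd u" using un by simp presburger
  with u un show ?thesis by (intro that) auto
qed

section \<open>Vertex covers, colors and genericity for odd \<open>n\<close>\<close>

text \<open>A cover of the path with \<open>2k + 1\<close> vertices meets each of the \<open>k\<close> disjoint edges
  \<open>{2i, 2i + 1}\<close>; with only \<open>k\<close> elements it must avoid \<open>2i + 1\<close> for each \<open>i\<close> in turn, which
  forces \<open>2i + 2\<close> into it.\<close>

lemma card_path_cover:
  fixes S :: "nat set"
  assumes "\<And>i. 1 \<le> i \<Longrightarrow> i \<le> 2 * k \<Longrightarrow> i \<in> S \<or> Suc i \<in> S"
  shows "k \<le> card (S \<inter> {1..2 * k + 1}) \<and>
    (card (S \<inter> {1..2 * k + 1}) = k \<longrightarrow> S \<inter> {1..2 * k + 1} = {i \<in> {1..2 * k + 1}. even i})"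
  using assms
proof (induction k)
  case 0
  then show ?case by (auto simp: card_eq_0_iff)
next
  case (Suc k)
  let ?A = "S \<inter> {1..2 * k + 1}" and ?B = "S \<inter> {2 * k + 2, 2 * k + 3}"
  have IH: "k \<le> card ?A" "card ?A = k \<Longrightarrow> ?A = {i \<in> {1..2 * k + 1}. even i}"
    using Suc.IH Suc.prems by auto
  have split: "S \<inter> {1..2 * Suc k + 1} = ?A \<union> ?B" by auto
  have card: "card (S \<inter> {1..2 * Suc k + 1}) = card ?A + card ?B"
    unfolding split by (rule card_Un_disjoint) auto
  have "?B \<noteq> {}" using Suc.prems[of "2 * k + 2"] by (auto simp: numeral_3_eq_3)
  then have B: "card ?B \<ge> 1" by (simp add: Suc_le_eq card_gt_0_iff)
  show ?case
  proof (intro conjI impI)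
    show "Suc k \<le> card (S \<inter> {1..2 * Suc k + 1})" using card B IH by linarith
    assume "card (S \<inter> {1..2 * Suc k + 1}) = Suc k"
    with card B IH(1) have eq: "card ?A = k" "card ?B = 1" by linarith+
    note A = IH(2)[OF eq(1)]
    have "2 * k + 1 \<notin> S"
    proof
      assume "2 * k + 1 \<in> S"
      then have "2 * k + 1 \<in> ?A" by simp
      then show False unfolding A by simp
    qed
    with Suc.prems[of "2 * k + 1"] have in': "2 * k + 2 \<in> S" by simp
    moreover have "2 * k + 3 \<notin> S"
    proof
      assume "2 * k + 3 \<in> S"
      with in' have "?B = {2 * k + 2, 2 * k + 3}" by auto
      with eq(2) show False by simp
    qed
    ultimately have "?B = {2 * k + 2}" by auto
    then have "S \<inter> {1..2 * Suc k + 1} = {i \<in> {1..2 * k + 1}. even i} \<union> {2 * k + 2}"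
      unfolding split A by simp
    also have "\<dots> = {i \<in> {1..2 * Suc k + 1}. even i}"
      by (rule set_eqI) (simp, presburger)
    finally show "S \<inter> {1..2 * Suc k + 1} = {i \<in> {1..2 * Suc k + 1}. even i}" .
  qed
qed

lemma vertex_cover_linear_tree_iff:
  "vertex_cover (linear_tree n) S \<longleftrightarrow>
    S \<subseteq> {1..n} \<and> (\<forall>i. 1 \<le> i \<and> i < n \<longrightarrow> i \<in> S \<or> Suc i \<in> S)"
  by (auto simp: vertex_cover_def linear_tree_def)

lemma card_even_atLeastAtMost: "card {i \<in> {1..2 * k + 1}. even i} = (k :: nat)"
proof -
  have "{i \<in> {1..2 * k + 1}. even i} = (*) 2 ` {1..k}"
    by (auto elim!: evenE)
  then show ?thesis by (simp add: card_image inj_on_def)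
qed

lemma card_odd_atLeastAtMost: "card {i \<in> {1..2 * k + 1}. odd i} = Suc k"
proof -
  have "{i \<in> {1..2 * k + 1}. odd i} = (\<lambda>i. 2 * i + 1) ` {..k}"
    by (auto elim!: oddE)
  then show ?thesis by (simp add: card_image inj_on_def)
qed

text \<open>The even vertices attain the bound of \<open>card_path_cover\<close>, and its equality
  case gives uniqueness.\<close>

lemma minimum_vertex_cover_linear_tree_odd:
  assumes "odd n"
  shows "minimum_vertex_cover (linear_tree n) S \<longleftrightarrow> S = {i \<in> {1..n}. even i}"
proof -
  obtain k where n: "n = 2 * k + 1" using assms by (elim oddE)
  let ?E = "{i \<in> {1..n}. even i}"
  have E: "vertex_cover (linear_tree n) ?E"
    by (auto simp: vertex_cover_linear_tree_iff)
  have cardE: "card ?E = k" using card_even_atLeastAtMost n by simp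
  have least: "k \<le> card S \<and> (card S = k \<longrightarrow> S = ?E)" if "vertex_cover (linear_tree n) S" for S
    using card_path_cover[of k S] that by (auto simp: vertex_cover_linear_tree_iff n Int_absorb2)
  show ?thesis
    unfolding minimum_vertex_cover_def using E cardE least by (metis le_antisym)
qed

lemma green_linear_tree_odd: "odd n \<Longrightarrow> green (linear_tree n) = {i \<in> {1..n}. even i}"
  by (auto simp: green_def minimum_vertex_cover_linear_tree_odd)

lemma red_linear_tree_odd: "odd n \<Longrightarrow> red (linear_tree n) = {i \<in> {1..n}. odd i}"
  by (auto simp: red_def minimum_vertex_cover_linear_tree_odd)

text \<open>Consecutive vertices have opposite colors, so the walk from 1 stays in one
  component.\<close>

lemma red_green_component_linear_tree_odd:
  assumes "odd n"
  obtains C where "C \<in> red_green_components (linear_tree n)" and "{1..n} \<subseteq> C"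
proof
  let ?R = "(red_green_adj (linear_tree n))\<^sup>*"
  have "1 \<in> red (linear_tree n)" using assms by (auto simp: red_linear_tree_odd odd_pos Suc_leI)
  then show "?R `` {1} \<in> red_green_components (linear_tree n)"
    by (auto simp: red_green_components_def intro: quotientI)
  have "(1, Suc i) \<in> ?R" if "i < n" for i
    using that
  proof (induction i)
    case (Suc i)
    then have "(Suc i, Suc (Suc i)) \<in> red_green_adj (linear_tree n)"
      using assms
      by (auto simp: red_green_adj_def edge_linear_tree_iff red_linear_tree_odd green_linear_tree_odd)
    with Suc show ?case by (auto intro: rtrancl_into_rtrancl)
  qed simp
  then show "{1..n} \<subseteq> ?R `` {1}"
    by (auto, metis One_nat_def Suc_le_D Suc_le_lessD)
qed

lemma uncovered_of_kind_const:
  assumes "uncovered T M \<subseteq> red T \<union> green T"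
  shows "uncovered_of_kind c T (\<lambda>_. c') M = (if c = c' then uncovered T M else {})"
proof -
  have "\<exists>C\<in>red_green_components T. u \<in> C" if "u \<in> uncovered T M" for u
    using that assms
    by (intro bexI[of _ "(red_green_adj T)\<^sup>* `` {u}"])
       (auto simp: red_green_components_def intro: quotientI)
  then show ?thesis by (auto simp: uncovered_of_kind_def)
qed

text \<open>For the set of all odd vertices with alternating signs, every factor away from
  \<open>u\<close> is 1, so the forbidden product is a forbidden value of \<alpha> at
  \<open>u\<close>.\<close>

lemma generic_parameters_linear_tree_odd:
  assumes "generic_parameters (linear_tree (2 * k + 1)) (\<lambda>_. generic) M \<alpha>"
    and "uncovered (linear_tree (2 * k + 1)) M = {u}" and "odd u"
  shows "\<alpha> u \<noteq> (- 1) ^ (k + 1)"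
proof -
  let ?n = "2 * k + 1"
  let ?T = "linear_tree ?n"
  let ?S = "{i \<in> {1..?n}. odd i}"
  have odd: "odd ?n" by simp
  obtain C where C: "C \<in> red_green_components ?T" "{1..?n} \<subseteq> C"
    using red_green_component_linear_tree_odd[OF odd] .
  \<comment> \<open>normalised so that \<open>\<epsilon>\<^sub>u = 1\<close>; consecutive odd vertices differ by 2\<close>
  define \<epsilon> :: "nat \<Rightarrow> int" where "\<epsilon> i = (if 4 dvd int i - int u then 1 else - 1)" for i
  have "card (neighbors ?T g \<inter> ?S) = 2" if "g \<in> green ?T" for g
  proof -
    have g: "g \<in> {1..?n}" "even g" using that by (auto simp: green_linear_tree_odd)
    then have "neighbors ?T g \<inter> ?S = {g - 1, Suc g}"
      unfolding neighbors_linear_tree[OF g(1)] by (auto; presburger)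
    with g show ?thesis by simp
  qed
  moreover have "1 \<in> ?S" by simp
  ultimately have adm: "admissible ?T C ?S"
    using C unfolding admissible_def red_linear_tree_odd[OF odd] by blast
  have "\<epsilon> i = - \<epsilon> j"
    if ij: "i \<in> ?S" "j \<in> ?S" "i \<noteq> j" and g: "g \<in> neighbors ?T i \<inter> neighbors ?T j" for i j g
  proof -
    have "j = i + 2 \<or> i = j + 2"
      using ij g by (auto simp: neighbors_linear_tree)
    moreover have "odd i" "odd j" using ij by auto
    ultimately show ?thesis using \<open>odd u\<close> unfolding \<epsilon>_def
      by (auto; presburger)
  qed
  moreover have "\<epsilon> i \<in> {1, - 1}" for i by (simp add: \<epsilon>_def)
  ultimately have alt: "alternating_signs ?T ?S \<epsilon>"
    unfolding alternating_signs_def by blast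
  have "u \<in> ?S" using assms(2,3) by (auto simp: uncovered_def)
  have "(\<Prod>i\<in>?S. (if i \<in> uncovered ?T M then \<alpha> i else 1) powi \<epsilon> i) =
      (\<Prod>i\<in>?S. if i = u then \<alpha> i else 1)"
    unfolding assms(2) by (rule prod.cong) (auto simp: \<epsilon>_def)
  also have "\<dots> = \<alpha> u"
    using \<open>u \<in> ?S\<close> by simp
  finally have "(\<Prod>i\<in>?S. (if i \<in> uncovered ?T M then \<alpha> i else 1) powi \<epsilon> i) = \<alpha> u" .
  moreover have "(\<Prod>i\<in>?S. (if i \<in> uncovered ?T M then \<alpha> i else 1) powi \<epsilon> i) \<noteq> (- 1) ^ card ?S"
    using assms(1) C(1) adm alt unfolding generic_parameters_def by blast
  ultimately have "\<alpha> u \<noteq> (- 1) ^ card ?S" by (simp only: not_False_eq_True)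
  then show ?thesis by (simp only: card_odd_atLeastAtMost Suc_eq_plus1 not_False_eq_True)
qed

section \<open>Points of the varieties\<close>

text \<open>Padding by 1 at 0 and \<open>n + 1\<close> treats end vertices and inner vertices
  alike.\<close>

lemma prod_neighbors_linear_tree:
  fixes x :: "nat \<Rightarrow> 'k::comm_monoid_mult" and n :: nat
  defines "X \<equiv> x(0 := 1, Suc n := 1)"
  assumes "i \<in> {1..n}"
  shows "(\<Prod>j\<in>neighbors (linear_tree n) i. x j) = X (i - 1) * X (Suc i)"
proof -
  have "(\<Prod>j\<in>neighbors (linear_tree n) i. x j) = (\<Prod>j\<in>neighbors (linear_tree n) i. X j)"
    using assms by (intro prod.cong) (auto simp: neighbors_linear_tree)
  also have "\<dots> = (\<Prod>j\<in>{i - 1, Suc i}. X j)"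
    using assms by (intro prod.mono_neutral_left) (auto simp: neighbors_linear_tree)
  finally show ?thesis by simp
qed

text \<open>This is the fibre of the variety over a fixed choice of the versal variables, which
  enter only through \<open>c\<close>.\<close>

definition linear_solutions ::
  "nat \<Rightarrow> (nat \<Rightarrow> 'k::field) \<Rightarrow> ((nat \<Rightarrow> 'k) \<times> (nat \<Rightarrow> 'k)) set" where
  "linear_solutions n c =
     {(x, x'). x \<in> {1..n} \<rightarrow>\<^sub>E UNIV \<and> x' \<in> {1..n} \<rightarrow>\<^sub>E UNIV \<and>
        (\<forall>i \<in> {1..n}. x i * x' i = 1 + c i * (\<Prod>j \<in> neighbors (linear_tree n) i. x j))}"

lemma card_linear_solutions:
  fixes c :: "nat \<Rightarrow> 'k::{field,finite}"
  assumes "n \<ge> 1"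
  shows "card (linear_solutions n c) = chain_count c n 1"
proof -
  define f where "f = (\<lambda>(x, x' :: nat \<Rightarrow> 'k). (x(0 := 1 :: 'k, Suc n := 1), x'))"
  \<comment> \<open>Resetting the padded positions to \<open>undefined\<close> restores
    extensionality on \<open>{1..n}\<close>.\<close>
  define g where "g = (\<lambda>(x, x' :: nat \<Rightarrow> 'k). (x(0 := undefined :: 'k, Suc n := undefined), x'))"
  let ?P = "\<Union>v. chain_points c n v 1"
  have "bij_betw f (linear_solutions n c) ?P"
  proof (rule bij_betw_byWitness[where f' = g])
    show "\<forall>a\<in>linear_solutions n c. g (f a) = a"
      by (auto simp: linear_solutions_def f_def g_def PiE_def extensional_def fun_eq_iff)
    show "\<forall>a\<in>?P. f (g a) = a"
      by (auto simp: chain_points_def f_def g_def fun_eq_iff)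
    show "f ` linear_solutions n c \<subseteq> ?P"
    proof (rule image_subsetI)
      fix p assume "p \<in> linear_solutions n c"
      moreover obtain x x' where "p = (x, x')" by (cases p)
      ultimately show "f p \<in> ?P"
        using assms prod_neighbors_linear_tree[of _ n x]
        by (auto simp: linear_solutions_def f_def chain_points_def PiE_def extensional_def mult.assoc)
    qed
    show "g ` ?P \<subseteq> linear_solutions n c"
    proof (rule image_subsetI)
      fix p assume "p \<in> ?P"
      moreover obtain x x' where p: "p = (x, x')" by (cases p)
      ultimately obtain v where *: "(x, x') \<in> chain_points c n v 1" by auto
      let ?y = "x(0 := undefined, Suc n := undefined)"
      have "?y(0 := 1, Suc n := 1) = x"
        using * by (auto simp: chain_points_def fun_eq_iff)
      then have "(\<Prod>j\<in>neighbors (linear_tree n) i. ?y j) = x (i - 1) * x (Suc i)"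
        if "i \<in> {1..n}" for i
        using prod_neighbors_linear_tree[OF that, of ?y] by simp
      with * show "g p \<in> linear_solutions n c"
        by (simp add: p linear_solutions_def g_def chain_points_def PiE_def extensional_def mult.assoc)
    qed
  qed
  then have "card (linear_solutions n c) = card ?P"
    by (rule bij_betw_same_card)
  also have "\<dots> = chain_count c n 1"
    unfolding chain_count_def by (rule card_UN_disjoint) (simp, simp, auto simp: chain_points_def)
  finally show ?thesis .
qed

lemma N_points_linear_tree:
  fixes \<alpha> :: "nat \<Rightarrow> 'k::{field,finite}"
  assumes "n \<ge> 1"
  shows "N_points (linear_tree n) \<phi> M \<alpha> =
    (\<Sum>a \<in> uncovered_of_kind versal (linear_tree n) \<phi> M \<rightarrow>\<^sub>E UNIV - {0}.
       chain_count (coefficient (linear_tree n) \<phi> M \<alpha> a) n 1)"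
proof -
  let ?U = "uncovered_of_kind versal (linear_tree n) \<phi> M"
  let ?A = "?U \<rightarrow>\<^sub>E UNIV - {0 :: 'k}"
  let ?R = "SIGMA a : ?A. linear_solutions n (coefficient (linear_tree n) \<phi> M \<alpha> a)"
  have "finite ?U"
    by (rule finite_subset[of _ "{1..n}"]) (auto simp: uncovered_of_kind_def uncovered_def)
  then have fin: "finite ?A" by (intro finite_PiE) auto
  have fin': "finite (linear_solutions n c)" for c :: "nat \<Rightarrow> 'k"
  proof (rule finite_subset)
    show "linear_solutions n c \<subseteq> ({1..n} \<rightarrow>\<^sub>E UNIV) \<times> ({1..n} \<rightarrow>\<^sub>E UNIV)"
      by (auto simp: linear_solutions_def)
  qed (intro finite_cartesian_product finite_PiE; simp)
  have "X_points (linear_tree n) \<phi> M \<alpha> = (\<lambda>(a, x, x'). (x, x', a)) ` ?R"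
    by (auto simp: X_points_def linear_solutions_def image_iff)
  then have "N_points (linear_tree n) \<phi> M \<alpha> = card ?R"
    by (simp add: N_points_def card_image inj_on_def split_beta prod_eq_iff)
  also have "\<dots> = (\<Sum>a\<in>?A. card (linear_solutions n (coefficient (linear_tree n) \<phi> M \<alpha> a)))"
    using fin fin' by (intro card_SigmaI) auto
  finally show ?thesis by (simp add: card_linear_solutions[OF assms])
qed

theorem proposition4p10:
  fixes n :: nat and M :: "nat set set" and \<phi> :: "nat set \<Rightarrow> kind"
    and \<alpha> :: "nat \<Rightarrow> 'k::{field,finite}" and q :: nat
  assumes "q = CARD('k)" and "n \<ge> 1" and "maximum_matching (linear_tree n) M"
  shows "(even n \<longrightarrow>
           real (N_points (linear_tree n) \<phi> M \<alpha>) = (real q ^ (n + 2) - 1) / (real q ^ 2 - 1)) \<and>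
         (odd n \<longrightarrow>
           real (N_points (linear_tree n) (\<lambda>_. versal) M \<alpha>) = (real q ^ (n + 2) + 1) / (real q + 1)) \<and>
         (odd n \<and> generic_parameters (linear_tree n) (\<lambda>_. generic) M \<alpha> \<longrightarrow>
           real (N_points (linear_tree n) (\<lambda>_. generic) M \<alpha>) =
             (real q ^ ((n + 1) div 2) - 1) * (real q ^ ((n + 3) div 2) - 1) / (real q ^ 2 - 1))"
proof -
  let ?T = "linear_tree n"
  have q: "real q > 1"
    using card_field_ge_2[where 'k = 'k] assms(1) by simp
  then have q2: "real q ^ 2 - 1 > 0" by (simp add: one_less_power)
  show ?thesis
  proof (cases "even n")
    case True
    then obtain k where n: "n = 2 * k" by (elim evenE)
    have unc: "uncovered ?T M = {}"
      using uncovered_linear_tree_even[OF assms(3) True] .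
    then have "uncovered_of_kind versal ?T \<phi> M = {}"
      by (simp add: uncovered_of_kind_def)
    \<comment> \<open>On the empty index set there is just one family of versal variables.\<close>
    then have "N_points ?T \<phi> M \<alpha> =
        chain_count (coefficient ?T \<phi> M \<alpha> (\<lambda>_. undefined)) n 1"
      by (simp add: N_points_linear_tree[OF assms(2)])
    moreover have "coefficient ?T \<phi> M \<alpha> a i = 1" for a i
      using unc by (simp add: coefficient_def)
    ultimately have "real (N_points ?T \<phi> M \<alpha>) = (real q ^ (n + 2) - 1) / (real q ^ 2 - 1)"
      using chain_count_even[of "coefficient ?T \<phi> M \<alpha> (\<lambda>_. undefined)" 1 k] q2 assms(1) n
      by (simp add: field_simps)
    with True show ?thesis by simp
  next
    case False
    then obtain k where n: "n = 2 * k + 1" by (elim oddE)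
    obtain u where u: "uncovered ?T M = {u}" "odd u" "u \<le> n"
      using uncovered_linear_tree_odd[OF assms(3) False] .
    have "uncovered ?T M \<subseteq> red ?T \<union> green ?T"
      using False by (auto simp: uncovered_def red_linear_tree_odd green_linear_tree_odd)
    note kind = uncovered_of_kind_const[OF this]
    \<comment> \<open>The count away from resonance, common to both odd cases.\<close>
    define G where "G = (real q ^ (k + 1) - 1) * (real q ^ (k + 2) - 1) / (real q ^ 2 - 1)"
    have count: "real (chain_count c n 1) = G + (if c u = (- 1) ^ (k + 1) then real q ^ (k + 1) else 0)"
      if c: "c u \<noteq> 0" "\<And>i. i \<noteq> u \<Longrightarrow> c i = 1" for c :: "nat \<Rightarrow> 'k"
    proof -
      have "c i \<noteq> 0" for i using c by (cases "i = u") auto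
      moreover have "1 = chain_resonance c k \<longleftrightarrow> c u = (- 1) ^ (k + 1)"
        using u n c by (intro chain_resonance_single_eq_1) auto
      moreover have "(real q ^ 2 - 1) * G = (real q ^ (k + 1) - 1) * (real q ^ (k + 2) - 1)"
        using q2 by (simp add: G_def)
      ultimately have "(real q ^ 2 - 1) * real (chain_count c n 1) =
          (real q ^ 2 - 1) * (G + (if c u = (- 1) ^ (k + 1) then real q ^ (k + 1) else 0))"
        using chain_count_odd[of c 1 k] unfolding n assms(1)
        by (simp only: distrib_left) simp
      then show ?thesis using q2 by simp
    qed
    have "real (N_points ?T (\<lambda>_. versal) M \<alpha>) = (\<Sum>a \<in> {u} \<rightarrow>\<^sub>E UNIV - {0}.
        real (chain_count (coefficient ?T (\<lambda>_. versal) M \<alpha> a) n 1))"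
      by (simp add: N_points_linear_tree[OF assms(2)] kind u)
    also have "\<dots> = (\<Sum>a \<in> {u} \<rightarrow>\<^sub>E UNIV - {0 :: 'k}.
        G + (if a u = (- 1) ^ (k + 1) then real q ^ (k + 1) else 0))"
    proof (rule sum.cong)
      fix a assume "a \<in> {u} \<rightarrow>\<^sub>E UNIV - {0 :: 'k}"
      then have "a u \<noteq> 0" by auto
      then show "real (chain_count (coefficient ?T (\<lambda>_. versal) M \<alpha> a) n 1) =
          G + (if a u = (- 1) ^ (k + 1) then real q ^ (k + 1) else 0)"
        by (subst count) (simp_all add: coefficient_def kind u)
    qed simp
    \<comment> \<open>A family indexed by \<open>{u}\<close> is the same as its value
      \<open>t\<close> at \<open>u\<close>.\<close>
    also have "\<dots> = (\<Sum>t \<in> UNIV - {0 :: 'k}.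
        G + (if t = (- 1) ^ (k + 1) then real q ^ (k + 1) else 0))"
      by (rule sum.reindex_bij_witness[of _ "\<lambda>t. \<lambda>i\<in>{u}. t" "\<lambda>a. a u"])
         (auto simp: PiE_def extensional_def fun_eq_iff)
    \<comment> \<open>Exactly one of the \<open>q - 1\<close> nonzero values of \<open>t\<close> is
      resonant.\<close>
    also have "\<dots> = (real q - 1) * G + real q ^ (k + 1)"
      unfolding sum.distrib using q
      by (simp add: card_Diff_subset assms(1) of_nat_diff)
    also have "\<dots> = (real q ^ (n + 2) + 1) / (real q + 1)"
    proof -
      have "real q ^ 2 - 1 = (real q - 1) * (real q + 1)"
        by (simp add: algebra_simps power2_eq_square)
      then have "(real q - 1) * G = (real q ^ (k + 1) - 1) * (real q ^ (k + 2) - 1) / (real q + 1)"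
        using q by (simp add: G_def)
      \<comment> \<open>With \<open>Q = q ^ (k + 1)\<close> the claim becomes
        \<open>(Q - 1) * (q * Q - 1) + (q + 1) * Q = q * Q\<^sup>2 + 1\<close>.\<close>
      moreover have "real q ^ (n + 2) = real q ^ (k + 1) * real q ^ (k + 2)"
        by (simp add: n mult_2 flip: power_add)
      moreover have "real q ^ (k + 2) = real q * real q ^ (k + 1)" by simp
      ultimately show ?thesis
        using q by (simp only:) (simp add: field_simps)
    qed
    finally have versal: "real (N_points ?T (\<lambda>_. versal) M \<alpha>) = (real q ^ (n + 2) + 1) / (real q + 1)" .
    have generic: "real (N_points ?T (\<lambda>_. generic) M \<alpha>) = G"
      if gen: "generic_parameters ?T (\<lambda>_. generic) M \<alpha>"
    proof -
      have "\<alpha> u \<noteq> 0"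
        using gen by (simp add: generic_parameters_def kind u)
      moreover have "\<alpha> u \<noteq> (- 1) ^ (k + 1)"
        using generic_parameters_linear_tree_odd[of k M \<alpha> u] gen u n by simp
      moreover have "N_points ?T (\<lambda>_. generic) M \<alpha> =
          chain_count (coefficient ?T (\<lambda>_. generic) M \<alpha> (\<lambda>_. undefined)) n 1"
        by (simp add: N_points_linear_tree[OF assms(2)] kind)
      ultimately show ?thesis
        using count[of "coefficient ?T (\<lambda>_. generic) M \<alpha> (\<lambda>_. undefined)"]
        by (simp add: coefficient_def kind u)
    qed
    have "(n + 1) div 2 = k + 1" "(n + 3) div 2 = k + 2" using n by auto
    with False versal generic show ?thesis by (simp add: G_def)
  qed
qed

end
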